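(* Let $1<s<p<\infty$, $n\ge2$, let $\Omega\subseteq\mathbb{R}^n$ be a domain, and let $a=(a_1,\dots,a_n)$ be a weight vector as in the context. Then there exists a positive constant $C(p,s,n)$, depending only on $p,s,n$, such that for almost all $x\in\Omega$ and all $\xi,\eta\in\mathbb{R}^n$ with $|\xi|_{s,a}>|\eta|_{s,a}$, $$D_{|\cdot|_{s,a}^{p}}(\xi+\eta,\xi)\le C(p,s,n)\,|\xi|_{s,a}^{p-s}\sum_{i=1}^{n}|\eta'_{i}|^{2}\left(|\eta'_{i}|+|\xi'_{i}|\right)^{s-2}.$$
   Context: The functions $a_1,\dots,a_n:\Omega\to(0,\infty)$ are Lebesgue measurable and locally equivalent to $1$: for every domain $\omega$ whose closure is a compact subset of $\Omega$ there are constants $0<c_\omega\le C_\omega<\infty$ with $c_\omega\le a_i\le C_\omega$ a.e. in $\omega$. For almost all $x\in\Omega$ and $\xi\in\mathbb{R}^n$, $|\xi|_{s,a}=\left(\sum_{i=1}^n a_i(x)|\xi_i|^s\right)^{1/s}$, and $\xi_i'=a_i(x)^{1/s}\xi_i$ (similarly $\eta_i'$). The Bregman distance of $|\cdot|_{s,a}^p$ is $$D_{|\cdot|_{s,a}^{p}}(\xi+\eta,\xi)=|\xi+\eta|_{s,a}^{p}-|\xi|_{s,a}^{p}-p|\xi|_{s,a}^{p-s}\sum_{i=1}^{n}a_{i}(x)|\xi_{i}|^{s-2}\xi_{i}\eta_{i}.$$ Conventions: $|t|^{s-2}t=0$ for $t=0$, and $t^2(t+\tau)^{s-2}=0$ when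 $t=\tau=0$. *)

theory Defs
  imports "HOL-Analysis.Analysis"
begin

definition is_domain :: "'a::topological_space set \<Rightarrow> bool" where
  "is_domain \<Omega> \<longleftrightarrow> open \<Omega> \<and> connected \<Omega> \<and> \<Omega> \<noteq> {}"

text \<open>
  The \<open>i\<close>-th weight is \<open>a i\<close>, a total function of which only the values on \<open>\<Omega>\<close> matter.
\<close>

definition weight_vector :: "(real ^ 'n) set \<Rightarrow> ('n::finite \<Rightarrow> real ^ 'n \<Rightarrow> real) \<Rightarrow> bool" where
  "weight_vector \<Omega> a \<longleftrightarrow>
     (\<forall>i. a i \<in> borel_measurable (lebesgue_on \<Omega>)) \<and>
     (\<forall>i. \<forall>x\<in>\<Omega>. a i x > 0) \<and>
     (\<forall>\<omega>. is_domain \<omega> \<and> compact (closure \<omega>) \<and> closure \<omega> \<subseteq> \<Omega> \<longrightarrow>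
        (\<exists>c C. 0 < c \<and> c \<le> C \<and>
           (\<forall>i. AE x in lebesgue_on \<omega>. c \<le> a i x \<and> a i x \<le> C)))"

definition anorm ::
    "real \<Rightarrow> ('n::finite \<Rightarrow> real ^ 'n \<Rightarrow> real) \<Rightarrow> real ^ 'n \<Rightarrow> real ^ 'n \<Rightarrow> real" where
  "anorm s a x \<xi> = (\<Sum>i\<in>UNIV. a i x * \<bar>\<xi> $ i\<bar> powr s) powr (1 / s)"

text \<open>The vector \<open>\<xi>'\<close> with components \<open>a\<^sub>i(x)\<^sup>1\<^sup>/\<^sup>s \<xi>\<^sub>i\<close>.\<close>

definition rescale ::
    "real \<Rightarrow> ('n::finite \<Rightarrow> real ^ 'n \<Rightarrow> real) \<Rightarrow> real ^ 'n \<Rightarrow> real ^ 'n \<Rightarrow> real ^ 'n" where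
  "rescale s a x \<xi> = (\<chi> i. a i x powr (1 / s) * \<xi> $ i)"

text \<open>
  \<open>bregman p s a x \<zeta> \<xi>\<close> is the Bregman distance \<open>D(\<zeta>, \<xi>)\<close> of the \<open>p\<close>-th power of \<open>anorm s a x\<close>;
  the increment \<open>\<eta>\<close> is \<open>\<zeta> - \<xi>\<close>.  Since \<open>0 powr r = 0\<close>, the summand
  \<open>|t|\<^sup>s\<^sup>-\<^sup>2 t\<close> is \<open>0\<close> at \<open>t = 0\<close>, as it should be.
\<close>

definition bregman ::
    "real \<Rightarrow> real \<Rightarrow> ('n::finite \<Rightarrow> real ^ 'n \<Rightarrow> real) \<Rightarrow> real ^ 'n \<Rightarrow> real ^ 'n \<Rightarrow> real ^ 'n \<Rightarrow> real"
  where
  "bregman p s a x \<zeta> \<xi> =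
     anorm s a x \<zeta> powr p - anorm s a x \<xi> powr p
     - p * anorm s a x \<xi> powr (p - s) *
       (\<Sum>i\<in>UNIV. a i x * (\<bar>\<xi> $ i\<bar> powr (s - 2) * \<xi> $ i) * (\<zeta> - \<xi>) $ i)"

end

theory Submission
  imports Defs
begin

text \<open>
  With \<open>u = \<xi>'\<close>, \<open>v = \<eta>'\<close>, \<open>q = p / s > 1\<close>, \<open>A = \<Sum>|u\<^sub>i|\<^sup>s\<close>, \<open>B = \<Sum>|u\<^sub>i + v\<^sub>i|\<^sup>s\<close> and
  \<open>L = \<Sum>|u\<^sub>i|\<^sup>s\<^sup>-\<^sup>2 u\<^sub>i v\<^sub>i\<close>, the Bregman distance splits as
  \<open>[B\<^sup>q - A\<^sup>q - q A\<^sup>q\<^sup>-\<^sup>1 (B - A)] + q A\<^sup>q\<^sup>-\<^sup>1 [B - A - s L]\<close>.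
  The second bracket is estimated term by term.  Since \<open>B\<close> is at most a multiple of \<open>A\<close>, the
  first one is at most a multiple of \<open>A\<^sup>q\<^sup>-\<^sup>2 (B - A)\<^sup>2\<close>.  Finally, with \<open>w\<^sub>i = |u\<^sub>i| + |v\<^sub>i|\<close>,
  \<open>|B - A| \<le> s \<Sum>|v\<^sub>i| w\<^sub>i\<^sup>s\<^sup>-\<^sup>1\<close>, so Cauchy-Schwarz bounds \<open>(B - A)\<^sup>2\<close> by
  \<open>s\<^sup>2 (\<Sum>v\<^sub>i\<^sup>2 w\<^sub>i\<^sup>s\<^sup>-\<^sup>2) (\<Sum>w\<^sub>i\<^sup>s)\<close>, where the last factor is again at most a multiple of \<open>A\<close>.
\<close>

section \<open>Tangent and quadratic remainder bounds for powers of nonnegative reals\<close>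

lemma powr_above_tangent:
  fixes s x y :: real
  assumes "s \<ge> 1" "x \<ge> 0" "y > 0"
  shows "s * y powr (s - 1) * (x - y) \<le> x powr s - y powr s"
\<comment> \<open>The convexity argument runs on the open half-line; at the endpoint
  \<open>x = 0\<close> the claim reduces to \<open>y powr s \<le> s * y powr s\<close>.\<close>
proof (cases "x = 0")
  case True
  have "y powr (s - 1) * y = y powr s"
    using assms by (simp add: powr_mult_base mult.commute)
  with True assms show ?thesis
    by (simp add: mult.assoc)
next
  case False
  have "convex_on {0<..} (\<lambda>z::real. z powr s)"
    using powr_convex[OF assms(1)] by (rule convex_on_subset) auto
  moreover have "((\<lambda>z. z powr s) has_real_derivative s * y powr (s - 1)) (at y within {0<..})"
    using assms by (auto intro!: derivative_eq_intros simp: field_simps powr_diff)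
  ultimately show ?thesis
    using assms False by (intro convex_on_imp_above_tangent[of "{0<..}"]) (auto simp: connected_Ioi interior_open)
qed

text \<open>The tangent at the larger of the two points bounds the difference, and
  \<open>s - 1 \<ge> 0\<close> allows its slope to be evaluated at \<open>c\<close> instead.\<close>

lemma abs_powr_diff_le:
  fixes s a b :: real
  assumes "s \<ge> 1" "0 \<le> a" "a \<le> c" "0 \<le> b" "b \<le> c"
  shows "\<bar>a powr s - b powr s\<bar> \<le> s * \<bar>a - b\<bar> * c powr (s - 1)"
proof -
  have *: "\<bar>x powr s - y powr s\<bar> \<le> s * \<bar>x - y\<bar> * c powr (s - 1)"
    if "0 \<le> x" "x < y" "y \<le> c" for x y
  proof -
    have "y powr s - x powr s \<le> s * y powr (s - 1) * (y - x)"
      using powr_above_tangent[of s x y] assms(1) that by (simp add: algebra_simps)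
    also have "\<dots> \<le> s * c powr (s - 1) * (y - x)"
      using assms(1) that by (intro mult_right_mono mult_left_mono powr_mono2) auto
    finally show ?thesis
      using that assms(1) powr_mono2[of s x y] by (simp add: algebra_simps)
  qed
  show ?thesis
    using *[of a b] *[of b a] assms by (cases a b rule: linorder_cases) (auto simp: abs_minus_commute)
qed

text \<open>For \<open>q < 2\<close> the second derivative of \<open>t powr q\<close> blows up at 0,
  so Taylor is avoided near 0. For \<open>t < 1/2\<close> the remainder is at most \<open>q\<close>,
  while \<open>(t - 1)\<^sup>2 \<ge> 1/4\<close>. For \<open>t \<ge> 1/2\<close> the tangent at
  \<open>t\<close>, not at 1, bounds it by \<open>q * (t powr (q - 1) - 1) * (t - 1)\<close>, and
  the mean value theorem supplies the second factor \<open>t - 1\<close>.\<close>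

lemma powr_remainder_at_one:
  fixes q K t :: real
  assumes q: "q > 1" and K: "K \<ge> 1" and t: "0 \<le> t" "t \<le> K"
  shows "t powr q - 1 - q * (t - 1) \<le> 4 * q * (1 + (q - 1) * K powr q) * (t - 1)\<^sup>2"
proof (cases "t < 1/2")
  case True
  have "t powr q \<le> 1"
    using powr_mono2[of q t 1] t True q by simp
  then have "t powr q - 1 - q * (t - 1) \<le> q"
    using mult_nonneg_nonneg[of q t] q t unfolding right_diff_distrib by linarith
  also have "\<dots> \<le> 4 * q * (t - 1)\<^sup>2"
  proof -
    have "(1/2)\<^sup>2 \<le> (1 - t)\<^sup>2"
      using True by (intro power_mono) auto
    then show ?thesis
      using q by (simp add: power2_commute power_divide)
  qed
  also have "\<dots> \<le> 4 * q * (1 + (q - 1) * K powr q) * (t - 1)\<^sup>2"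
    using q by (intro mult_right_mono) auto
  finally show ?thesis .
next
  case False
  have MVT: "\<bar>y powr (q - 1) - x powr (q - 1)\<bar> \<le> (q - 1) * (4 * K powr q) * \<bar>y - x\<bar>"
    if xy: "1/2 \<le> x" "x < y" "y \<le> K" for x y
  proof -
    have "((\<lambda>z. z powr (q - 1)) has_real_derivative (q - 1) * z powr (q - 2)) (at z)"
      if "x \<le> z" for z
      using has_real_derivative_powr[of z "q - 1"] that xy by simp
    then obtain z where z: "x < z" "z < y"
      and eq: "y powr (q - 1) - x powr (q - 1) = (y - x) * ((q - 1) * z powr (q - 2))"
      using MVT2[OF xy(2), of "\<lambda>z. z powr (q - 1)" "\<lambda>z. (q - 1) * z powr (q - 2)"]
      by blast
    have z2: "1/4 \<le> z\<^sup>2"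
      using power_mono[of "1/2" z 2] z xy by (simp add: power_divide)
    \<comment> \<open>Bounding numerator and denominator separately covers both signs of
      \<open>q - 2\<close>; the 4 comes from \<open>z > 1/2\<close>.\<close>
    have "z powr (q - 2) = z powr q / z\<^sup>2"
      using z xy by (simp add: powr_diff powr_numeral)
    also have "\<dots> \<le> K powr q / (1/4)"
      using z xy q z2 by (intro frac_le powr_mono2) auto
    finally have "(y - x) * ((q - 1) * z powr (q - 2)) \<le> (y - x) * ((q - 1) * (4 * K powr q))"
      using q xy by (intro mult_left_mono) auto
    moreover have "0 \<le> (y - x) * ((q - 1) * z powr (q - 2))"
      using q xy by simp
    ultimately show ?thesis
      using xy by (simp add: eq mult_ac)
  qed
  have "\<bar>t powr (q - 1) - 1\<bar> \<le> (q - 1) * (4 * K powr q) * \<bar>t - 1\<bar>"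
    using MVT[of t 1] MVT[of 1 t] False K t q
    by (cases t "1::real" rule: linorder_cases) (auto simp: abs_minus_commute)
  then have "\<bar>t powr (q - 1) - 1\<bar> * \<bar>t - 1\<bar> \<le> (q - 1) * (4 * K powr q) * \<bar>t - 1\<bar> * \<bar>t - 1\<bar>"
    by (intro mult_right_mono) auto
  then have "(t powr (q - 1) - 1) * (t - 1) \<le> (q - 1) * (4 * K powr q) * (t - 1)\<^sup>2"
    by (simp add: power2_eq_square abs_mult[symmetric] mult.assoc)
  then have "q * ((t powr (q - 1) - 1) * (t - 1)) \<le> q * ((q - 1) * (4 * K powr q) * (t - 1)\<^sup>2)"
    using q by (intro mult_left_mono) auto
  moreover have "q * t powr (q - 1) * (1 - t) \<le> 1 - t powr q"
    using powr_above_tangent[of q 1 t] q False by simp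
  moreover have "0 \<le> q * (t - 1)\<^sup>2"
    using q by simp
  ultimately show ?thesis
    by (simp add: algebra_simps)
qed

text \<open>Both sides are homogeneous of degree \<open>q\<close> in \<open>(A, B)\<close>, so
  division by \<open>A powr q\<close> reduces to \<open>t = B / A\<close>.\<close>

lemma powr_remainder:
  fixes q K A B :: real
  assumes "q > 1" "K \<ge> 1" "A > 0" "0 \<le> B" "B \<le> K * A"
  shows "B powr q - A powr q - q * A powr (q - 1) * (B - A)
    \<le> 4 * q * (1 + (q - 1) * K powr q) * A powr (q - 2) * (B - A)\<^sup>2"
proof -
  define t where "t = B / A"
  have B: "B = t * A" and t: "0 \<le> t" "t \<le> K"
    using assms by (auto simp: t_def field_simps)
  have 1: "A powr (q - 1) * A = A powr q" "A powr (q - 2) * A\<^sup>2 = A powr q"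
    using assms by (auto simp: powr_diff powr_numeral field_simps)
  have "B powr q - A powr q - q * A powr (q - 1) * (B - A)
      = A powr q * (t powr q - 1 - q * (t - 1))"
    using t assms by (simp add: B powr_mult 1(1)[symmetric] algebra_simps)
  also have "\<dots> \<le> A powr q * (4 * q * (1 + (q - 1) * K powr q) * (t - 1)\<^sup>2)"
    using powr_remainder_at_one[OF assms(1,2) t] by (intro mult_left_mono) auto
  also have "\<dots> = 4 * q * (1 + (q - 1) * K powr q) * A powr (q - 2) * (B - A)\<^sup>2"
  proof -
    have "(B - A)\<^sup>2 = A\<^sup>2 * (t - 1)\<^sup>2"
      by (simp add: B power2_eq_square algebra_simps)
    then show ?thesis
      by (simp add: 1(2)[symmetric] mult_ac)
  qed
  finally show ?thesis .
qed

section \<open>Remainder of the s-th power of the absolute value on the real line\<close>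

text \<open>The first summand serves increments with \<open>|u| < 2 |v|\<close>, the second those with \<open>2 |v| \<le> |u|\<close>.\<close>

definition scalar_const :: "real \<Rightarrow> real" where
  "scalar_const s = 9 * (1 + s) + 4 * s * (1 + (s - 1) * 2 powr s) * 4"

text \<open>If \<open>2 * \<bar>v\<bar> \<le> u\<close>, then \<open>u + v\<close> lies between 0
  and \<open>2 * u\<close>, and \<open>powr_remainder\<close> applies with \<open>K = 2\<close>.
  Otherwise \<open>w \<le> 3 * \<bar>v\<bar>\<close>, so \<open>w powr s\<close>, which controls
  every term, is at most \<open>9 * (v\<^sup>2 * w powr (s - 2))\<close>.\<close>

lemma abs_powr_remainder_nonneg:
  fixes s u v :: real
  assumes s: "s > 1" and u: "u \<ge> 0"
  shows "\<bar>u + v\<bar> powr s - u powr s - s * (u powr (s - 2) * u) * v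
    \<le> scalar_const s * (v\<^sup>2 * (\<bar>v\<bar> + u) powr (s - 2))"
proof -
  define w where "w = \<bar>v\<bar> + u"
  define C where "C = 4 * s * (1 + (s - 1) * 2 powr s)"
  have C: "C \<ge> 0"
    using s by (simp add: C_def)
  have pos: "0 \<le> v\<^sup>2 * w powr (s - 2)"
    by simp
  have u1: "u powr (s - 2) * u = u powr (s - 1)"
    using u by (cases "u = 0") (auto simp: powr_diff powr_numeral power2_eq_square)
  show ?thesis
  proof (cases "2 * \<bar>v\<bar> \<le> u")
    case True
    show ?thesis
    proof (cases "u = 0")
      case True
      with \<open>2 * \<bar>v\<bar> \<le> u\<close> show ?thesis by simp
    next
      case False
      with u have u0: "u > 0" by simp
      have "(u + v) powr s - u powr s - s * u powr (s - 1) * (u + v - u)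
          \<le> C * u powr (s - 2) * (u + v - u)\<^sup>2"
        unfolding C_def using True u0 s by (intro powr_remainder) auto
      also have "\<dots> = C * (v\<^sup>2 * u powr (s - 2))"
        by simp
      also have "\<dots> \<le> C * (4 * (v\<^sup>2 * w powr (s - 2)))"
      proof -
        have w: "u \<le> w" "w \<le> 2 * u"
          using True by (auto simp: w_def)
        have "w\<^sup>2 \<le> (2 * u)\<^sup>2"
          using w u0 by (intro power_mono) auto
        \<comment> \<open>Writing the power \<open>s - 2\<close> as a quotient makes the comparison
          of \<open>u\<close> with \<open>w\<close> independent of whether
          \<open>s < 2\<close>.\<close>
        then have "u powr s / (4 * u\<^sup>2) \<le> w powr s / w\<^sup>2"
          using w u0 s by (intro frac_le powr_mono2) auto
        then have "u powr (s - 2) \<le> 4 * w powr (s - 2)"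
          using w u0 by (simp add: powr_diff powr_numeral)
        then have "v\<^sup>2 * u powr (s - 2) \<le> v\<^sup>2 * (4 * w powr (s - 2))"
          by (intro mult_left_mono) auto
        then show ?thesis
          using C by (intro mult_left_mono) auto
      qed
      also have "\<dots> \<le> scalar_const s * (v\<^sup>2 * w powr (s - 2))"
      proof -
        have "C * 4 \<le> scalar_const s"
          using s by (simp add: scalar_const_def C_def)
        from mult_right_mono[OF this pos] show ?thesis
          by (simp only: mult.assoc)
      qed
      finally show ?thesis
        using True u by (simp add: u1 w_def)
    qed
  next
    case False
    then have w: "w > 0" "w \<le> 3 * \<bar>v\<bar>"
      using u by (auto simp: w_def)
    have "\<bar>u + v\<bar> powr s \<le> w powr s"
      using u s by (intro powr_mono2) (auto simp: w_def)
    moreover have "- (s * u powr (s - 1) * v) \<le> s * w powr s"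
    proof -
      have "u powr (s - 1) * (- v) \<le> u powr (s - 1) * \<bar>v\<bar>"
        by (intro mult_left_mono) auto
      also have "\<dots> \<le> w powr (s - 1) * w"
        using u s by (intro mult_mono powr_mono2) (auto simp: w_def)
      also have "\<dots> = w powr s"
        using w by (simp add: powr_diff)
      finally have "s * (u powr (s - 1) * (- v)) \<le> s * w powr s"
        using s by (intro mult_left_mono) auto
      then show ?thesis
        by (simp add: mult_ac)
    qed
    moreover have "w powr s \<le> 9 * (v\<^sup>2 * w powr (s - 2))"
    proof -
      have "w\<^sup>2 \<le> (3 * \<bar>v\<bar>)\<^sup>2"
        using w by (intro power_mono) auto
      then have "w powr (s - 2) * w\<^sup>2 \<le> w powr (s - 2) * (9 * v\<^sup>2)"
        by (intro mult_left_mono) (auto simp: power_mult_distrib)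
      moreover have "w powr s = w powr (s - 2) * w\<^sup>2"
        using w by (simp add: powr_diff powr_numeral)
      ultimately show ?thesis
        by (simp add: mult_ac)
    qed
    then have "(1 + s) * w powr s \<le> (1 + s) * (9 * (v\<^sup>2 * w powr (s - 2)))"
      using s by (intro mult_left_mono) auto
    moreover have "(1 + s) * (9 * (v\<^sup>2 * w powr (s - 2))) \<le> scalar_const s * (v\<^sup>2 * w powr (s - 2))"
    proof -
      have "(1 + s) * 9 \<le> scalar_const s"
        using s by (simp add: scalar_const_def)
      from mult_right_mono[OF this pos] show ?thesis
        by (simp only: mult.assoc)
    qed
    moreover have "u powr s \<ge> 0"
      by simp
    ultimately show ?thesis
      unfolding u1 w_def[symmetric] distrib_right by linarith
  qed
qed

text \<open>Both sides are unchanged when \<open>u\<close> and \<open>v\<close> are both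
  negated.\<close>

lemma abs_powr_remainder:
  fixes s u v :: real
  assumes "s > 1"
  shows "\<bar>u + v\<bar> powr s - \<bar>u\<bar> powr s - s * (\<bar>u\<bar> powr (s - 2) * u) * v
    \<le> scalar_const s * (v\<^sup>2 * (\<bar>v\<bar> + \<bar>u\<bar>) powr (s - 2))"
proof (cases "u \<ge> 0")
  case True
  then show ?thesis
    using abs_powr_remainder_nonneg[OF assms True, of v] by simp
next
  case False
  have "\<bar>- u - v\<bar> = \<bar>u + v\<bar>"
    by simp
  then show ?thesis
    using abs_powr_remainder_nonneg[OF assms, of "- u" "- v"] False by simp
qed

section \<open>Summation over the coordinates\<close>

text \<open>With \<open>q = p / s\<close> and \<open>K = 2 * 2 powr s\<close>, the first summand is
  the constant of \<open>powr_remainder\<close> times the Cauchy-Schwarz factor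
  \<open>s\<^sup>2 * K\<close>; the second is the coordinatewise constant times the outer derivative
  factor \<open>q\<close>.\<close>

definition bregman_const :: "real \<Rightarrow> real \<Rightarrow> real" where
  "bregman_const p s =
     4 * (p / s) * (1 + (p / s - 1) * (2 * 2 powr s) powr (p / s)) * (s\<^sup>2 * (2 * 2 powr s))
     + p / s * scalar_const s"

lemma sum_powr_remainder:
  fixes u v :: "'i \<Rightarrow> real"
  assumes s: "1 < s" "s < p"
    and less: "(\<Sum>i\<in>I. \<bar>v i\<bar> powr s) < (\<Sum>i\<in>I. \<bar>u i\<bar> powr s)"
  shows "(\<Sum>i\<in>I. \<bar>u i + v i\<bar> powr s) powr (p / s) - (\<Sum>i\<in>I. \<bar>u i\<bar> powr s) powr (p / s)
      - p * (\<Sum>i\<in>I. \<bar>u i\<bar> powr s) powr (p / s - 1) * (\<Sum>i\<in>I. \<bar>u i\<bar> powr (s - 2) * u i * v i)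
    \<le> bregman_const p s * (\<Sum>i\<in>I. \<bar>u i\<bar> powr s) powr (p / s - 1)
      * (\<Sum>i\<in>I. (v i)\<^sup>2 * (\<bar>v i\<bar> + \<bar>u i\<bar>) powr (s - 2))"
proof -
  define q where "q = p / s"
  define K where "K = 2 * 2 powr s"
  define w where "w i = \<bar>v i\<bar> + \<bar>u i\<bar>" for i
  define A where "A = (\<Sum>i\<in>I. \<bar>u i\<bar> powr s)"
  define B where "B = (\<Sum>i\<in>I. \<bar>u i + v i\<bar> powr s)"
  define W where "W = (\<Sum>i\<in>I. w i powr s)"
  define L where "L = (\<Sum>i\<in>I. \<bar>u i\<bar> powr (s - 2) * u i * v i)"
  define S where "S = (\<Sum>i\<in>I. (v i)\<^sup>2 * w i powr (s - 2))"
  define M where "M = 4 * q * (1 + (q - 1) * K powr q)"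
  have q: "q > 1" and p: "p = q * s"
    using s by (auto simp: q_def)
  have M: "M \<ge> 0"
    using q by (simp add: M_def)
  have K: "K \<ge> 1"
    using ge_one_powr_ge_zero[of 2 s] s by (simp add: K_def)
  have w: "w i \<ge> 0" for i
    by (simp add: w_def)
  have "(\<Sum>i\<in>I. \<bar>v i\<bar> powr s) \<ge> 0" and S: "S \<ge> 0" and B: "B \<ge> 0"
    by (auto simp: S_def B_def intro!: sum_nonneg)
  with less have A: "A > 0"
    by (simp add: A_def)
  \<comment> \<open>In \<open>K\<close>, the factor \<open>2 powr s\<close> comes from
    \<open>w i\<close> being at most twice a maximum, the other 2 from \<open>less\<close>, which
    absorbs the sum over \<open>v\<close> into \<open>A\<close>.\<close>
  have W: "W \<le> K * A"
  proof -
    have "w i powr s \<le> 2 powr s * (\<bar>v i\<bar> powr s + \<bar>u i\<bar> powr s)" for i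
    proof -
      have "w i powr s \<le> (2 * max \<bar>v i\<bar> \<bar>u i\<bar>) powr s"
        using s by (intro powr_mono2) (auto simp: w_def)
      also have "\<dots> = 2 powr s * max \<bar>v i\<bar> \<bar>u i\<bar> powr s"
        by (simp add: powr_mult)
      also have "\<dots> \<le> 2 powr s * (\<bar>v i\<bar> powr s + \<bar>u i\<bar> powr s)"
        by (intro mult_left_mono) (auto simp: max_def)
      finally show ?thesis .
    qed
    then have "W \<le> (\<Sum>i\<in>I. 2 powr s * (\<bar>v i\<bar> powr s + \<bar>u i\<bar> powr s))"
      unfolding W_def by (intro sum_mono)
    also have "\<dots> = 2 powr s * ((\<Sum>i\<in>I. \<bar>v i\<bar> powr s) + A)"
      by (simp add: A_def sum.distrib sum_distrib_left distrib_left)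
    also have "\<dots> \<le> 2 powr s * (A + A)"
      using less by (intro mult_left_mono) (auto simp: A_def)
    finally show ?thesis
      by (simp add: K_def)
  qed
  have "B \<le> W"
    unfolding B_def W_def using s by (intro sum_mono powr_mono2) (auto simp: w_def)
  with W have BK: "B \<le> K * A"
    by simp
  have diff: "(B - A)\<^sup>2 \<le> s\<^sup>2 * S * (K * A)"
  proof -
    have "\<bar>B - A\<bar> \<le> (\<Sum>i\<in>I. \<bar>\<bar>u i + v i\<bar> powr s - \<bar>u i\<bar> powr s\<bar>)"
      unfolding A_def B_def sum_subtractf[symmetric] by (rule sum_abs)
    also have "\<dots> \<le> (\<Sum>i\<in>I. s * (\<bar>v i\<bar> * w i powr (s - 1)))"
    proof (rule sum_mono)
      fix i
      have "\<bar>\<bar>u i + v i\<bar> powr s - \<bar>u i\<bar> powr s\<bar>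
          \<le> s * \<bar>\<bar>u i + v i\<bar> - \<bar>u i\<bar>\<bar> * w i powr (s - 1)"
        using s by (intro abs_powr_diff_le) (auto simp: w_def)
      also have "\<dots> \<le> s * \<bar>v i\<bar> * w i powr (s - 1)"
        using s by (intro mult_right_mono mult_left_mono) auto
      finally show "\<bar>\<bar>u i + v i\<bar> powr s - \<bar>u i\<bar> powr s\<bar> \<le> s * (\<bar>v i\<bar> * w i powr (s - 1))"
        by (simp add: mult.assoc)
    qed
    \<comment> \<open>Splitting the exponent \<open>s - 1\<close> this way makes the squares in
      Cauchy-Schwarz sum to exactly \<open>S\<close> and \<open>W\<close>. At \<open>w i = 0\<close>
      both sides vanish because \<open>0 powr r = 0\<close>.\<close>
    also have "\<dots> = s * (\<Sum>i\<in>I. (\<bar>v i\<bar> * w i powr (s / 2 - 1)) * w i powr (s / 2))"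
      by (simp add: sum_distrib_left mult.assoc powr_add[symmetric])
    finally have "(B - A)\<^sup>2
        \<le> (s * (\<Sum>i\<in>I. (\<bar>v i\<bar> * w i powr (s / 2 - 1)) * w i powr (s / 2)))\<^sup>2"
      using abs_le_square_iff by fastforce
    also have "\<dots> = s\<^sup>2 * (\<Sum>i\<in>I. (\<bar>v i\<bar> * w i powr (s / 2 - 1)) * w i powr (s / 2))\<^sup>2"
      by (simp add: power_mult_distrib)
    also have "\<dots> \<le> s\<^sup>2 * ((\<Sum>i\<in>I. (\<bar>v i\<bar> * w i powr (s / 2 - 1))\<^sup>2) * (\<Sum>i\<in>I. (w i powr (s / 2))\<^sup>2))"
      by (intro mult_left_mono Cauchy_Schwarz_ineq_sum) auto
    also have "\<dots> = s\<^sup>2 * (S * W)"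
    proof -
      have "(w i powr (s / 2 - 1))\<^sup>2 = w i powr (s - 2)" "(w i powr (s / 2))\<^sup>2 = w i powr s" for i
        by (simp_all add: power2_eq_square powr_add[symmetric])
      then show ?thesis
        by (simp add: S_def W_def power_mult_distrib)
    qed
    also have "\<dots> \<le> s\<^sup>2 * (S * (K * A))"
      using S W by (intro mult_left_mono) auto
    finally show ?thesis
      by (simp add: mult_ac)
  qed
  have outer: "B powr q - A powr q - q * A powr (q - 1) * (B - A)
      \<le> M * (s\<^sup>2 * K) * A powr (q - 1) * S"
  proof -
    have "B powr q - A powr q - q * A powr (q - 1) * (B - A) \<le> M * A powr (q - 2) * (B - A)\<^sup>2"
      unfolding M_def using q K A B BK by (intro powr_remainder) auto
    also have "\<dots> \<le> M * A powr (q - 2) * (s\<^sup>2 * S * (K * A))"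
      using M diff by (intro mult_left_mono) auto
    also have "\<dots> = M * (s\<^sup>2 * K) * (A powr (q - 2) * A) * S"
      by (simp add: mult_ac)
    also have "A powr (q - 2) * A = A powr (q - 1)"
      using A by (simp add: powr_diff powr_numeral power2_eq_square)
    finally show ?thesis .
  qed
  have "B - A - s * L \<le> scalar_const s * S"
  proof -
    have "B - A - s * L
        = (\<Sum>i\<in>I. \<bar>u i + v i\<bar> powr s - \<bar>u i\<bar> powr s - s * (\<bar>u i\<bar> powr (s - 2) * u i) * v i)"
      by (simp add: A_def B_def L_def sum_subtractf sum_distrib_left mult.assoc)
    also have "\<dots> \<le> (\<Sum>i\<in>I. scalar_const s * ((v i)\<^sup>2 * w i powr (s - 2)))"
      unfolding w_def using s by (intro sum_mono abs_powr_remainder)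
    finally show ?thesis
      by (simp add: S_def sum_distrib_left)
  qed
  then have "q * A powr (q - 1) * (B - A - s * L) \<le> q * A powr (q - 1) * (scalar_const s * S)"
    using q by (intro mult_left_mono) auto
  \<comment> \<open>Adding the two brackets cancels the \<open>B - A\<close> terms, and
    \<open>q * s = p\<close> gives the coefficient of \<open>L\<close>.\<close>
  with outer have "B powr q - A powr q - p * A powr (q - 1) * L
      \<le> (M * (s\<^sup>2 * K) + q * scalar_const s) * A powr (q - 1) * S"
    by (simp add: p algebra_simps)
  also have "M * (s\<^sup>2 * K) + q * scalar_const s = bregman_const p s"
    by (simp add: M_def K_def q_def bregman_const_def)
  finally show ?thesis
    by (simp add: A_def B_def L_def S_def q_def w_def)
qed

section \<open>Passage from rescaled coordinates to the weighted norm\<close>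

lemma anorm_powr:
  assumes "s > 0" "\<And>i. a i x > 0"
  shows "anorm s a x \<xi> powr r = (\<Sum>i\<in>UNIV. \<bar>rescale s a x \<xi> $ i\<bar> powr s) powr (r / s)"
proof -
  have "\<bar>rescale s a x \<xi> $ i\<bar> powr s = a i x * \<bar>\<xi> $ i\<bar> powr s" for i
    using assms less_imp_le[OF assms(2)] by (simp add: rescale_def abs_mult powr_mult powr_powr)
  then show ?thesis
    by (simp add: anorm_def powr_powr)
qed

lemma bregman_le:
  assumes s: "1 < s" "s < p" and a: "\<And>i. a i x > 0"
    and less: "anorm s a x \<eta> < anorm s a x \<xi>"
  shows "bregman p s a x (\<xi> + \<eta>) \<xi> \<le> bregman_const p s * anorm s a x \<xi> powr (p - s) *
    (\<Sum>i\<in>UNIV. \<bar>rescale s a x \<eta> $ i\<bar>\<^sup>2 *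
      (\<bar>rescale s a x \<eta> $ i\<bar> + \<bar>rescale s a x \<xi> $ i\<bar>) powr (s - 2))"
proof -
  define u where "u i = rescale s a x \<xi> $ i" for i
  define v where "v i = rescale s a x \<eta> $ i" for i
  have pw: "anorm s a x \<xi> powr r = (\<Sum>i\<in>UNIV. \<bar>u i\<bar> powr s) powr (r / s)"
    "anorm s a x \<eta> powr r = (\<Sum>i\<in>UNIV. \<bar>v i\<bar> powr s) powr (r / s)"
    "anorm s a x (\<xi> + \<eta>) powr r = (\<Sum>i\<in>UNIV. \<bar>u i + v i\<bar> powr s) powr (r / s)" for r
    using s by (simp_all add: anorm_powr[of s a x, OF _ a] u_def v_def) (simp add: rescale_def distrib_left)
  have "anorm s a x \<eta> powr s < anorm s a x \<xi> powr s"
    using s less by (intro powr_less_mono2) (auto simp: anorm_def)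
  then have less': "(\<Sum>i\<in>UNIV. \<bar>v i\<bar> powr s) < (\<Sum>i\<in>UNIV. \<bar>u i\<bar> powr s)"
    using s by (simp add: pw sum_nonneg)
  have "\<bar>u i\<bar> powr (s - 2) * u i * v i = a i x * (\<bar>\<xi> $ i\<bar> powr (s - 2) * \<xi> $ i) * \<eta> $ i" for i
  proof -
    \<comment> \<open>The exponents add up to \<open>(s - 2) / s + 2 / s = 1\<close>, so rescaling
      absorbs exactly one weight per summand of the linear term.\<close>
    have "(a i x powr (1 / s)) powr (s - 2) * (a i x powr (1 / s) * a i x powr (1 / s)) = a i x"
      using s less_imp_le[OF a] by (simp add: powr_powr powr_add[symmetric] diff_divide_distrib)
    moreover have "\<bar>u i\<bar> powr (s - 2) * u i * v i
        = (a i x powr (1 / s)) powr (s - 2) * (a i x powr (1 / s) * a i x powr (1 / s))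
          * (\<bar>\<xi> $ i\<bar> powr (s - 2) * \<xi> $ i) * \<eta> $ i"
      by (simp add: u_def v_def rescale_def abs_mult powr_mult)
    ultimately show ?thesis
      by simp
  qed
  moreover have "(p - s) / s = p / s - 1"
    using s by (simp add: diff_divide_distrib)
  ultimately show ?thesis
    using sum_powr_remainder[OF s less']
    by (simp add: bregman_def pw u_def[symmetric] v_def[symmetric])
qed

theorem lemma3p15:
  fixes p s :: real
  assumes "1 < s" and "s < p" and "CARD('n::finite) \<ge> 2"
  shows "\<exists>C>0. \<forall>(\<Omega> :: (real ^ 'n) set) (a :: 'n \<Rightarrow> real ^ 'n \<Rightarrow> real).
           is_domain \<Omega> \<and> weight_vector \<Omega> a \<longrightarrow>
           (AE x in lebesgue_on \<Omega>. \<forall>\<xi> \<eta> :: real ^ 'n. anorm s a x \<xi> > anorm s a x \<eta> \<longrightarrow>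
              bregman p s a x (\<xi> + \<eta>) \<xi> \<le>
                C * anorm s a x \<xi> powr (p - s) *
                (\<Sum>i\<in>UNIV. \<bar>rescale s a x \<eta> $ i\<bar>\<^sup>2 *
                   (\<bar>rescale s a x \<eta> $ i\<bar> + \<bar>rescale s a x \<xi> $ i\<bar>) powr (s - 2)))"
proof (intro exI[of _ "bregman_const p s"] conjI allI impI)
  have "scalar_const s > 0" "p / s > 1"
    using assms by (auto simp: scalar_const_def intro!: add_pos_nonneg)
  then show "bregman_const p s > 0"
    unfolding bregman_const_def by (intro add_nonneg_pos mult_nonneg_nonneg mult_pos_pos) auto
next
  fix \<Omega> :: "(real ^ 'n) set" and a :: "'n \<Rightarrow> real ^ 'n \<Rightarrow> real"
  assume "is_domain \<Omega> \<and> weight_vector \<Omega> a"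
  then have "a i x > 0" if "x \<in> \<Omega>" for i x
    using that by (auto simp: weight_vector_def)
  then show "AE x in lebesgue_on \<Omega>. \<forall>\<xi> \<eta> :: real ^ 'n. anorm s a x \<xi> > anorm s a x \<eta> \<longrightarrow>
              bregman p s a x (\<xi> + \<eta>) \<xi> \<le>
                bregman_const p s * anorm s a x \<xi> powr (p - s) *
                (\<Sum>i\<in>UNIV. \<bar>rescale s a x \<eta> $ i\<bar>\<^sup>2 *
                   (\<bar>rescale s a x \<eta> $ i\<bar> + \<bar>rescale s a x \<xi> $ i\<bar>) powr (s - 2))"
    \<comment> \<open>The bound holds at every point of \<Omega>, with a constant fixed before
      \<Omega> and \<open>a\<close>.\<close>
    using assms by (intro AE_I2 allI impI bregman_le) auto
qed

end
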